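(* Let $m\ge 3$ and $n\ge 2$ be integers. Not every tensor of order $m$ and dimension $n$ is similar to an upper triangular tensor; that is, there exists a tensor $\mathbb{A}$ of order $m$ and dimension $n$ that is not similar to any upper triangular tensor of order $m$ and dimension $n$.
   Context: Write $[n]=\{1,\ldots,n\}$. An order $m$ dimension $n$ tensor $\mathbb{A}=(a_{i_1i_2\ldots i_m})$ is a multidimensional array of complex numbers $a_{i_1\ldots i_m}$ indexed by $i_1,\ldots,i_m\in[n]$. The unit tensor of order $m$ and dimension $n$ is $\mathbb{I}=(\delta_{i_1\ldots i_m})$ with $\delta_{i_1\ldots i_m}=1$ if $i_1=\cdots=i_m$ and $0$ otherwise. For complex matrices $P=(p_{ij}),Q=(q_{ij})$ of order $n$ and a tensor $\mathbb{A}$ of order $m$ and dimension $n$, the product $P\mathbb{A}Q$ is the order $m$ dimension $n$ tensor with entries $$(P\mathbb{A}Q)_{i_1\ldots i_m}=\sum_{j_1,\ldots,j_m=1}^n p_{i_1j_1}a_{j_1j_2\ldots j_m}q_{j_2i_2}\cdots q_{j_mi_m}.$$ Two order $m$ dimension $n$ tensors $\mathbb{A},\mathbb{B}$ are similar if there exist matrices $P,Q$ of order $n$ with $P\mathbb{I}Q=\mathbb{I}$ and $\mathbb{B}=P\mathbb{A}Q$. A tensor $\mathbb{A}=(a_{i_1\ldots i_m})$ of order $m\ge 3$ is upper triangular if $a_{i_1i_2\ldots i_m}=0$ whenever $\min\{i_2,\ldots,i_m\}<i_1$. *)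

theory Defs
  imports Complex_Main "HOL-Library.FuncSet" "Jordan_Normal_Form.Matrix"
begin

text \<open>
  Indices are counted from 0, as for the matrices of \<^theory>\<open>Jordan_Normal_Form.Matrix\<close>: the index
  set \<open>[n]\<close> is \<open>{..<n}\<close>, and the tuple \<open>(i\<^sub>1, \<dots>, i\<^sub>m)\<close> is a list \<open>i\<close> with \<open>i\<^sub>k\<close> at position \<open>k - 1\<close>.
\<close>

definition tensor_indices :: "nat \<Rightarrow> nat \<Rightarrow> nat list set" where
  "tensor_indices m n = {i. length i = m \<and> set i \<subseteq> {..<n}}"

lemma finite_tensor_indices: "finite (tensor_indices m n)"
  using finite_lists_length_eq[of "{..<n}" m]
  by (simp add: tensor_indices_def conj_commute)

text \<open>Tensors are extensional functions, so that equality of tensors is equality of all entries.\<close>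

definition carrier_tensor :: "nat \<Rightarrow> nat \<Rightarrow> (nat list \<Rightarrow> complex) set" where
  "carrier_tensor m n = tensor_indices m n \<rightarrow>\<^sub>E UNIV"

definition unit_tensor :: "nat \<Rightarrow> nat \<Rightarrow> nat list \<Rightarrow> complex" where
  "unit_tensor m n = (\<lambda>i\<in>tensor_indices m n. if \<forall>k<m. i ! k = i ! 0 then 1 else 0)"

definition tensor_prod ::
  "nat \<Rightarrow> nat \<Rightarrow> complex mat \<Rightarrow> (nat list \<Rightarrow> complex) \<Rightarrow> complex mat \<Rightarrow> nat list \<Rightarrow> complex" where
  "tensor_prod m n P A Q = (\<lambda>i\<in>tensor_indices m n.
     \<Sum>j\<in>tensor_indices m n. P $$ (i ! 0, j ! 0) * A j * (\<Prod>k = 1..<m. Q $$ (j ! k, i ! k)))"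

definition similar_tensor ::
  "nat \<Rightarrow> nat \<Rightarrow> (nat list \<Rightarrow> complex) \<Rightarrow> (nat list \<Rightarrow> complex) \<Rightarrow> bool" where
  "similar_tensor m n A B \<longleftrightarrow>
     (\<exists>P \<in> carrier_mat n n. \<exists>Q \<in> carrier_mat n n.
        tensor_prod m n P (unit_tensor m n) Q = unit_tensor m n \<and> B = tensor_prod m n P A Q)"

definition upper_triangular_tensor :: "nat \<Rightarrow> nat \<Rightarrow> (nat list \<Rightarrow> complex) \<Rightarrow> bool" where
  "upper_triangular_tensor m n A \<longleftrightarrow>
     (\<forall>i \<in> tensor_indices m n. Min (set (tl i)) < hd i \<longrightarrow> A i = 0)"

end

theory Submission
  imports Defs "Jordan_Normal_Form.Determinant"
begin

text \<open>
  A pair \<open>P, Q\<close> with \<open>P \<I> Q = \<I>\<close> is very rigid: for order at least 3, both matrices are monomial,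
  with a common permutation \<open>\<sigma>\<close> that carries the nonzero entries (lemma
  \<open>unit_preserving_monomial\<close>).  Hence, up to nonzero factors, similarity only renames the indices,
  and a tensor without zero entries is carried to a tensor without zero entries (lemma
  \<open>tensor_prod_nonzero\<close>).  A triangular
  tensor, however, vanishes at the index \<open>(1, 0, \<dots>, 0)\<close>; so the tensor with all entries 1 is not
  similar to a triangular one.

  Rigidity comes from reading \<open>P \<I> Q = \<I>\<close> at the indices \<open>(a, b, c, \<dots>, c)\<close>.  With
  \<open>D\<^sub>c = diag (Q\<^sub>s\<^sub>c ^ (m - 2))\<^sub>s\<close> and the matrix unit \<open>E\<^sub>c\<^sub>c\<close> this says \<open>P D\<^sub>c Q = E\<^sub>c\<^sub>c\<close> for every \<open>c\<close>.
  Summing over \<open>c\<close> gives \<open>P D Q = 1\<close> with \<open>D = \<Sum>\<^sub>c D\<^sub>c\<close>, so \<open>Q (P D) = 1\<close> because the matrices are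
  square, and multiplying \<open>P D\<^sub>c Q = E\<^sub>c\<^sub>c\<close> by \<open>P D\<close> from the right gives \<open>P D\<^sub>c = E\<^sub>c\<^sub>c P D\<close>.
  Only row \<open>c\<close> of \<open>P D\<^sub>c\<close> can therefore be nonzero, which for \<open>m \<ge> 3\<close> says that \<open>Q\<^sub>s\<^sub>c \<noteq> 0\<close> forces
  \<open>P\<^sub>a\<^sub>s = 0\<close> for all \<open>a \<noteq> c\<close> (lemma \<open>unit_preserving_row_vanishes\<close>).
\<close>

lemma tensor_prod_unit_entry:
  assumes "m \<ge> 1" and i: "i \<in> tensor_indices m n"
  shows "tensor_prod m n P (unit_tensor m n) Q i
       = (\<Sum>s<n. P $$ (i ! 0, s) * (\<Prod>k = 1..<m. Q $$ (s, i ! k)))"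
proof -
  let ?f = "\<lambda>j. P $$ (i ! 0, j ! 0) * unit_tensor m n j * (\<Prod>k = 1..<m. Q $$ (j ! k, i ! k))"
  let ?diag = "(\<lambda>s. replicate m s) ` {..<n}"
  have sub: "?diag \<subseteq> tensor_indices m n"
    by (auto simp: tensor_indices_def)
  have "?f j = 0" if j: "j \<in> tensor_indices m n - ?diag" for j
  proof -
    have "\<not> (\<forall>k<m. j ! k = j ! 0)"
    proof
      assume const: "\<forall>k<m. j ! k = j ! 0"
      have len: "length j = m" and j0: "j ! 0 < n"
        using j \<open>m \<ge> 1\<close> by (auto simp: tensor_indices_def subset_iff)
      have repl: "j = replicate m (j ! 0)"
      proof (rule nth_equalityI)
        fix k assume "k < length j"
        then have "k < m" by (simp only: len)
        then show "j ! k = replicate m (j ! 0) ! k"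
          using const by (metis nth_replicate)
      qed (simp only: len length_replicate)
      have "j \<in> ?diag"
        by (rule image_eqI, rule repl) (simp add: j0)
      with j show False by blast
    qed
    then have "unit_tensor m n j = 0"
      using j by (simp only: unit_tensor_def restrict_apply DiffD1 if_True if_False)
    then show ?thesis by simp
  qed
  then have "sum ?f (tensor_indices m n) = sum ?f ?diag"
    by (intro sum.mono_neutral_right finite_tensor_indices sub) auto
  also have "\<dots> = (\<Sum>s<n. ?f (replicate m s))"
    using \<open>m \<ge> 1\<close> by (subst sum.reindex) (auto simp: inj_on_def)
  also have "\<dots> = (\<Sum>s<n. P $$ (i ! 0, s) * (\<Prod>k = 1..<m. Q $$ (s, i ! k)))"
    using \<open>m \<ge> 1\<close> sub by (intro sum.cong) (auto simp: unit_tensor_def)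
  finally show ?thesis using i by (simp add: tensor_prod_def)
qed

text \<open>The entry form of \<open>P D\<^sub>c Q = E\<^sub>c\<^sub>c\<close>.\<close>

lemma unit_preserving_contract:
  assumes "m \<ge> 3"
    and fixed: "tensor_prod m n P (unit_tensor m n) Q = unit_tensor m n"
    and "a < n" "b < n" "c < n"
  shows "(\<Sum>s<n. P $$ (a, s) * (Q $$ (s, b) * Q $$ (s, c) ^ (m - 2)))
       = (if a = b \<and> b = c then 1 else 0)"
proof -
  let ?i = "a # b # replicate (m - 2) c"
  have i: "?i \<in> tensor_indices m n"
    using assms by (auto simp: tensor_indices_def)
  have "(\<Prod>k = 1..<m. Q $$ (s, ?i ! k)) = Q $$ (s, b) * Q $$ (s, c) ^ (m - 2)" for s
  proof -
    have "(\<Prod>k = 1..<m. Q $$ (s, ?i ! k)) = Q $$ (s, ?i ! 1) * (\<Prod>k = 2..<m. Q $$ (s, ?i ! k))"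
      using \<open>m \<ge> 3\<close> by (subst prod.atLeast_Suc_lessThan) (auto simp: numeral_2_eq_2)
    also have "(\<Prod>k = 2..<m. Q $$ (s, ?i ! k)) = (\<Prod>k = 2..<m. Q $$ (s, c))"
      by (intro prod.cong) (auto simp: nth_Cons')
    finally show ?thesis by simp
  qed
  moreover have "(\<forall>k<m. ?i ! k = ?i ! 0) \<longleftrightarrow> a = b \<and> b = c"
  proof
    assume const: "\<forall>k<m. ?i ! k = ?i ! 0"
    have "?i ! 1 = a" "?i ! 2 = a"
      using const[rule_format, of 1] const[rule_format, of 2] \<open>m \<ge> 3\<close> by auto
    then show "a = b \<and> b = c" using \<open>m \<ge> 3\<close> by (simp add: numeral_2_eq_2)
  qed (auto simp: nth_Cons')
  ultimately show ?thesis
    using tensor_prod_unit_entry[OF _ i, of P Q] fixed i \<open>m \<ge> 3\<close>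
    by (simp add: unit_tensor_def)
qed

lemma unit_preserving_row_vanishes:
  assumes m: "m \<ge> 3"
    and P: "P \<in> carrier_mat n n" and Q: "Q \<in> carrier_mat n n"
    and fixed: "tensor_prod m n P (unit_tensor m n) Q = unit_tensor m n"
    and "a < n" "c < n" "s < n" and nz: "Q $$ (s, c) \<noteq> 0" and "a \<noteq> c"
  shows "P $$ (a, s) = 0"
proof -
  note contract = unit_preserving_contract[OF m fixed]
  \<comment> \<open>\<open>d\<close> is the diagonal of \<open>D\<close>, and \<open>R = P D\<close>.\<close>
  define d where "d s = (\<Sum>c<n. Q $$ (s, c) ^ (m - 2))" for s
  define R where "R = mat n n (\<lambda>(b, s). P $$ (b, s) * d s)"
  have R: "R \<in> carrier_mat n n" by (simp add: R_def)
  have "R * Q = 1\<^sub>m n"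
  proof (rule eq_matI)
    fix a b assume ab: "a < dim_row (1\<^sub>m n)" "b < dim_col (1\<^sub>m n)"
    then have "(R * Q) $$ (a, b) = (\<Sum>s<n. P $$ (a, s) * d s * Q $$ (s, b))"
      using Q by (auto simp: R_def scalar_prod_def atLeast0LessThan intro!: sum.cong)
    also have "\<dots> = (\<Sum>s<n. \<Sum>c<n. P $$ (a, s) * (Q $$ (s, b) * Q $$ (s, c) ^ (m - 2)))"
      by (simp add: d_def sum_distrib_left sum_distrib_right mult_ac)
    also have "\<dots> = (\<Sum>c<n. if a = b \<and> b = c then 1 else 0)"
      using ab by (subst sum.swap) (simp add: contract)
    also have "\<dots> = 1\<^sub>m n $$ (a, b)" using ab by auto
    finally show "(R * Q) $$ (a, b) = 1\<^sub>m n $$ (a, b)" .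
  qed (use Q in \<open>auto simp: R_def\<close>)
  then have QR: "Q * R = 1\<^sub>m n"
    using mat_mult_left_right_inverse[OF R Q] by simp
  have delta: "(\<Sum>b<n. Q $$ (t, b) * (P $$ (b, s) * d s)) = (if t = s then 1 else 0)"
    if "t < n" for t
  proof -
    have "(Q * R) $$ (t, s) = (\<Sum>b<n. Q $$ (t, b) * (P $$ (b, s) * d s))"
      using Q that \<open>s < n\<close>
      by (auto simp: R_def scalar_prod_def atLeast0LessThan intro!: sum.cong)
    then show ?thesis using QR that \<open>s < n\<close> by simp
  qed
  \<comment> \<open>Inserting \<open>1 = Q (P D)\<close> after \<open>P D\<^sub>c\<close> makes the factor \<open>P D\<^sub>c Q = E\<^sub>c\<^sub>c\<close> appear, whose row \<open>a\<close> is 0.\<close>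
  have "P $$ (a, s) * Q $$ (s, c) ^ (m - 2)
      = (\<Sum>t<n. P $$ (a, t) * Q $$ (t, c) ^ (m - 2) * (if t = s then 1 else 0))"
    using \<open>s < n\<close> by (simp add: if_distrib cong: if_cong)
  also have "\<dots> = (\<Sum>t<n. P $$ (a, t) * Q $$ (t, c) ^ (m - 2)
                      * (\<Sum>b<n. Q $$ (t, b) * (P $$ (b, s) * d s)))"
    by (intro sum.cong) (auto simp: delta)
  also have "\<dots> = (\<Sum>t<n. \<Sum>b<n. P $$ (a, t) * (Q $$ (t, b) * Q $$ (t, c) ^ (m - 2))
                      * (P $$ (b, s) * d s))"
    by (simp add: sum_distrib_left mult_ac)
  also have "\<dots> = (\<Sum>b<n. (\<Sum>t<n. P $$ (a, t) * (Q $$ (t, b) * Q $$ (t, c) ^ (m - 2)))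
                      * (P $$ (b, s) * d s))"
    by (subst sum.swap) (simp add: sum_distrib_right)
  also have "\<dots> = 0"
    using assms by (intro sum.neutral) (auto simp: contract)
  finally show ?thesis using nz by simp
qed

text \<open>
  The diagonal entries of \<open>P \<I> Q = \<I>\<close> supply, for every \<open>c\<close>, some \<open>\<sigma> c\<close> with \<open>P\<close> nonzero at
  \<open>(c, \<sigma> c)\<close> and \<open>Q\<close> nonzero at \<open>(\<sigma> c, c)\<close>.  The vanishing of rows makes \<open>\<sigma>\<close> injective, hence onto,
  and then leaves no room for further nonzero entries.
\<close>

lemma unit_preserving_monomial:
  assumes m: "m \<ge> 3"
    and P: "P \<in> carrier_mat n n" and Q: "Q \<in> carrier_mat n n"
    and fixed: "tensor_prod m n P (unit_tensor m n) Q = unit_tensor m n"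
  obtains \<sigma> where "\<And>c. c < n \<Longrightarrow> \<sigma> c < n"
    and "\<And>c s. c < n \<Longrightarrow> s < n \<Longrightarrow> P $$ (c, s) \<noteq> 0 \<longleftrightarrow> s = \<sigma> c"
    and "\<And>c s. c < n \<Longrightarrow> s < n \<Longrightarrow> Q $$ (s, c) \<noteq> 0 \<longleftrightarrow> s = \<sigma> c"
proof -
  note row = unit_preserving_row_vanishes[OF assms]
  have "\<exists>s<n. P $$ (c, s) \<noteq> 0 \<and> Q $$ (s, c) \<noteq> 0" if "c < n" for c
  proof (rule ccontr)
    assume none: "\<not> (\<exists>s<n. P $$ (c, s) \<noteq> 0 \<and> Q $$ (s, c) \<noteq> 0)"
    have "(\<Sum>s<n. P $$ (c, s) * (Q $$ (s, c) * Q $$ (s, c) ^ (m - 2))) = 0"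
      using none by (intro sum.neutral) auto
    then show False using unit_preserving_contract[OF m fixed that that that] by simp
  qed
  then obtain \<sigma> where \<sigma>: "\<And>c. c < n \<Longrightarrow> \<sigma> c < n \<and> P $$ (c, \<sigma> c) \<noteq> 0 \<and> Q $$ (\<sigma> c, c) \<noteq> 0"
    by metis
  have "inj_on \<sigma> {..<n}"
    using \<sigma> row by (metis inj_onI lessThan_iff)
  then have onto: "\<sigma> ` {..<n} = {..<n}"
    using \<sigma> by (intro endo_inj_surj) auto
  show thesis
  proof
    fix c s assume cs: "c < n" "s < n"
    then obtain d where d: "d < n" "s = \<sigma> d" using onto by (metis imageE lessThan_iff)
    show "P $$ (c, s) \<noteq> 0 \<longleftrightarrow> s = \<sigma> c"
      using \<sigma>[of c] \<sigma>[of d] row[of c d s] cs d by metis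
    show "Q $$ (s, c) \<noteq> 0 \<longleftrightarrow> s = \<sigma> c"
      using \<sigma>[of c] \<sigma>[of d] row[of d c s] cs d by metis
  qed (use \<sigma> in blast)
qed

text \<open>In each entry of the product, monomiality leaves a single summand.\<close>

lemma tensor_prod_nonzero:
  assumes m: "m \<ge> 3"
    and P: "P \<in> carrier_mat n n" and Q: "Q \<in> carrier_mat n n"
    and fixed: "tensor_prod m n P (unit_tensor m n) Q = unit_tensor m n"
    and A: "\<And>j. j \<in> tensor_indices m n \<Longrightarrow> A j \<noteq> 0"
    and i: "i \<in> tensor_indices m n"
  shows "tensor_prod m n P A Q i \<noteq> 0"
proof -
  obtain \<sigma> where \<sigma>: "\<And>c. c < n \<Longrightarrow> \<sigma> c < n"
    and P\<sigma>: "\<And>c s. c < n \<Longrightarrow> s < n \<Longrightarrow> P $$ (c, s) \<noteq> 0 \<longleftrightarrow> s = \<sigma> c"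
    and Q\<sigma>: "\<And>c s. c < n \<Longrightarrow> s < n \<Longrightarrow> Q $$ (s, c) \<noteq> 0 \<longleftrightarrow> s = \<sigma> c"
    using unit_preserving_monomial[OF m P Q fixed] by blast
  let ?f = "\<lambda>j. P $$ (i ! 0, j ! 0) * A j * (\<Prod>k = 1..<m. Q $$ (j ! k, i ! k))"
  have bound: "j ! k < n" if "j \<in> tensor_indices m n" "k < m" for j k
    using that by (auto simp: tensor_indices_def subset_iff)
  have len: "length i = m" using i by (simp add: tensor_indices_def)
  have \<sigma>i: "map \<sigma> i \<in> tensor_indices m n"
    using i \<sigma> by (auto simp: tensor_indices_def)
  have "?f j = 0" if j: "j \<in> tensor_indices m n" "j \<noteq> map \<sigma> i" for j
  proof -
    obtain k where k: "k < m" "j ! k \<noteq> \<sigma> (i ! k)"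
      using j len by (auto simp: tensor_indices_def list_eq_iff_nth_eq)
    show ?thesis
    proof (cases "k = 0")
      case True
      then show ?thesis using P\<sigma>[of "i ! 0" "j ! 0"] bound[OF i] bound[OF j(1)] k by auto
    next
      case False
      moreover have "Q $$ (j ! k, i ! k) = 0"
        using Q\<sigma>[of "i ! k" "j ! k"] bound[OF i] bound[OF j(1)] k by auto
      ultimately have "(\<Prod>k = 1..<m. Q $$ (j ! k, i ! k)) = 0"
        using k by (intro prod_zero) auto
      then show ?thesis by simp
    qed
  qed
  then have "sum ?f (tensor_indices m n) = sum ?f {map \<sigma> i}"
    by (intro sum.mono_neutral_right finite_tensor_indices) (use \<sigma>i in auto)
  moreover have "P $$ (i ! 0, map \<sigma> i ! 0) \<noteq> 0"
    using P\<sigma>[of "i ! 0" "\<sigma> (i ! 0)"] \<sigma> bound[OF i, of 0] m len by auto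
  moreover have "Q $$ (map \<sigma> i ! k, i ! k) \<noteq> 0" if "k < m" for k
    using Q\<sigma>[of "i ! k" "\<sigma> (i ! k)"] \<sigma> bound[OF i, of k] that len by auto
  ultimately show ?thesis
    using i A[OF \<sigma>i] by (simp add: tensor_prod_def)
qed

theorem mainTheorem6:
  fixes m n :: nat
  assumes "m \<ge> 3" and "n \<ge> 2"
  shows "\<exists>A \<in> carrier_tensor m n.
    \<not> (\<exists>B \<in> carrier_tensor m n. upper_triangular_tensor m n B \<and> similar_tensor m n A B)"
proof
  let ?A = "\<lambda>i\<in>tensor_indices m n. 1 :: complex"
  show "?A \<in> carrier_tensor m n" by (simp add: carrier_tensor_def)
  show "\<not> (\<exists>B \<in> carrier_tensor m n. upper_triangular_tensor m n B \<and> similar_tensor m n ?A B)"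
  proof
    assume "\<exists>B \<in> carrier_tensor m n. upper_triangular_tensor m n B \<and> similar_tensor m n ?A B"
    then obtain P Q where PQ: "P \<in> carrier_mat n n" "Q \<in> carrier_mat n n"
        "tensor_prod m n P (unit_tensor m n) Q = unit_tensor m n"
      and upper: "upper_triangular_tensor m n (tensor_prod m n P ?A Q)"
      by (auto simp: similar_tensor_def)
    let ?i = "1 # replicate (m - 1) (0 :: nat)"
    have i: "?i \<in> tensor_indices m n"
      using assms by (auto simp: tensor_indices_def)
    have "Min (set (tl ?i)) < hd ?i" using assms by simp
    then have "tensor_prod m n P ?A Q ?i = 0"
      using upper i unfolding upper_triangular_tensor_def by blast
    moreover have "tensor_prod m n P ?A Q ?i \<noteq> 0"
      by (rule tensor_prod_nonzero[OF \<open>m \<ge> 3\<close> PQ _ i]) simp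
    ultimately show False by contradiction
  qed
qed

end
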